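(* Let $h>0$, $(\alpha_1,\beta_1)=(\tfrac12,\tfrac18)$, $(\alpha_2,\beta_2)=(1,\tfrac16)$, $j\in\{1,2\}$. Assume that $A_h$ and $B_h$ are simultaneously diagonalized by the Fourier basis, with mode symbols $a_k\in\mathbb C$ and $b_k\le0$ (real), respectively. Let $$M_j=I-\alpha_jhB_h+\beta_jh^2B_h(A_h+B_h),\qquad P_j^{(2)}=I-\alpha_jhB_h+\beta_jh^2B_h^2 .$$ Then the preconditioned correction on mode $k$, i.e. the symbol of $(P_j^{(2)})^{-1}M_j-I$, is $$E_{j,k}=\frac{\beta_jh^2b_ka_k}{1-\alpha_jhb_k+\beta_jh^2b_k^2},$$ and $$|E_{j,k}|\le\frac{|a_k|}{|b_k|}\qquad(b_k\ne0).$$ For constant-coefficient advection–diffusion, $a_k=ic\xi_k$ and $b_k=-\nu\xi_k^2$ (with $c\in\mathbb R$, $\nu>0$, wave numbers $\xi_k\neq0$), hence $$|E_{j,k}|\le\frac{|c|}{\nu|\xi_k|}.$$ Therefore diffusion-dominated high-frequency modes cluster toward the identity as $|\xi_k|\to\infty$ (that is, $E_{j,k}\to0$), uniformly with respect to the magnitude of $h|b_k|$.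
   Context: $M_j$ are the implicit stage operators (midpoint $j=1$, endpoint $j=2$) of the compact two-stage method for linear semi-discrete operators $F_h=A_hU$, $G_h=B_hU$, and $P_j^{(2)}$ is the quadratic preconditioner. *)

theory Defs
  imports Complex_Main "Jordan_Normal_Form.Gauss_Jordan_Elimination"
begin

(* The mode exp(i xi x), xi = 2 pi k / L, sampled at the points x = m L / N (m < N) of the uniform
   periodic grid; the period L cancels, and k only matters modulo N. *)
definition fourier_mode :: "nat \<Rightarrow> nat \<Rightarrow> complex vec" where
  "fourier_mode N k = vec N (\<lambda>m. cis (2 * pi * real k * real m / real N))"

(* The operator T on grid functions is diagonal in the Fourier basis, with mode symbols s k.  As the
   modes are nonzero, the values s k for k < N are determined by T. *)
definition has_fourier_symbol :: "nat \<Rightarrow> complex mat \<Rightarrow> (nat \<Rightarrow> complex) \<Rightarrow> bool" where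
  "has_fourier_symbol N T s \<longleftrightarrow>
     T \<in> carrier_mat N N \<and>
     (\<forall>k<N. T *\<^sub>v fourier_mode N k = s k \<cdot>\<^sub>v fourier_mode N k)"

(* Only the stages j = 1 (midpoint) and j = 2 (endpoint) are meaningful. *)
definition stage_alpha :: "nat \<Rightarrow> real" where
  "stage_alpha j = (if j = 1 then 1 / 2 else 1)"

definition stage_beta :: "nat \<Rightarrow> real" where
  "stage_beta j = (if j = 1 then 1 / 8 else 1 / 6)"

definition stage_op :: "nat \<Rightarrow> real \<Rightarrow> complex mat \<Rightarrow> complex mat \<Rightarrow> complex mat" where
  "stage_op j h A B =
     1\<^sub>m (dim_row B) - complex_of_real (stage_alpha j * h) \<cdot>\<^sub>m B
       + complex_of_real (stage_beta j * h\<^sup>2) \<cdot>\<^sub>m (B * (A + B))"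

definition quad_precond :: "nat \<Rightarrow> real \<Rightarrow> complex mat \<Rightarrow> complex mat" where
  "quad_precond j h B =
     1\<^sub>m (dim_row B) - complex_of_real (stage_alpha j * h) \<cdot>\<^sub>m B
       + complex_of_real (stage_beta j * h\<^sup>2) \<cdot>\<^sub>m (B * B)"

(* mat_inverse returns Some inverse exactly for invertible matrices, so this is meaningful only
   if the preconditioner is invertible. *)
definition precond_correction :: "nat \<Rightarrow> real \<Rightarrow> complex mat \<Rightarrow> complex mat \<Rightarrow> complex mat" where
  "precond_correction j h A B =
     the (mat_inverse (quad_precond j h B)) * stage_op j h A B - 1\<^sub>m (dim_row B)"

(* The wave numbers xi k are arbitrary reals, so that any convention for numbering the modes modulo N
   and any period are covered; the constant mode, with wave number 0, is allowed here. *)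
definition advection_diffusion ::
  "nat \<Rightarrow> real \<Rightarrow> real \<Rightarrow> (nat \<Rightarrow> real) \<Rightarrow> complex mat \<Rightarrow> complex mat \<Rightarrow> bool" where
  "advection_diffusion N c \<nu> \<xi> A B \<longleftrightarrow>
     has_fourier_symbol N A (\<lambda>k. \<i> * complex_of_real (c * \<xi> k)) \<and>
     has_fourier_symbol N B (\<lambda>k. complex_of_real (- \<nu> * (\<xi> k)\<^sup>2))"

end

theory Submission
  imports Defs "Jordan_Normal_Form.Determinant"
begin

text \<open>
  Inverse discrete Fourier transformation shows that the matrix of Fourier modes is invertible, so an
  operator that is diagonal in the Fourier basis is invertible once its symbol vanishes nowhere.
  As \<open>b \<le> 0\<close>, the preconditioner has symbol \<open>1 - \<alpha> h b + \<beta> h\<^sup>2 b\<^sup>2 \<ge> 1\<close>, and the symbol calculus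
  yields the formula for the correction. Its bound comes from discarding the nonnegative part
  \<open>1 - \<alpha> h b\<close> of the denominator, which is why it does not depend on the size of \<open>h b\<close>.
\<close>

section \<open>Orthogonality of characters and inversion of the discrete Fourier transform\<close>

text \<open>The sum is geometric with ratio \<open>w\<close>, an \<open>N\<close>-th root of unity.
  It vanishes because \<open>w = 1\<close> would make \<open>d\<close> a multiple of
  \<open>N\<close>. The range of \<open>d\<close> covers all differences of two distinct grid
  indices.\<close>

lemma sum_cis_character:
  fixes d :: int
  assumes "N > 0" "d \<noteq> 0" "\<bar>d\<bar> < int N"
  shows "(\<Sum>k<N. cis (2 * pi * real k * real_of_int d / real N)) = 0"
proof -
  define w where "w = cis (2 * pi * real_of_int d / real N)"
  have pow: "cis (2 * pi * real k * real_of_int d / real N) = w ^ k" for k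
    unfolding w_def DeMoivre by (rule arg_cong[of _ _ cis]) simp
  have "w ^ N = cis (2 * pi * real_of_int d)"
    unfolding w_def DeMoivre using assms by (intro arg_cong[of _ _ cis]) simp
  also have "\<dots> = 1"
    by (simp add: cis_multiple_2pi)
  finally have wN: "w ^ N = 1" .
  have "w \<noteq> 1"
  proof
    assume "w = 1"
    then have "cos (2 * pi * real_of_int d / real N) = 1"
      by (metis w_def cis.sel(1) one_complex.sel(1))
    then obtain n :: int where "2 * pi * real_of_int d / real N = of_int n * 2 * pi"
      using cos_one_2pi_int by blast
    then have "real_of_int d = real_of_int (n * int N)"
      using assms by (simp add: field_simps)
    then have "d = n * int N"
      by linarith
    then show False
      using assms by (metis abs_of_nat dvd_imp_le_int dvd_triv_right not_le)
  qed
  then show ?thesis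
    unfolding pow using wN by (simp add: geometric_sum)
qed

text \<open>With the modes as columns, invertibility of this matrix says that they form a
  basis.\<close>

definition fourier_matrix :: "nat \<Rightarrow> complex mat" where
  "fourier_matrix N = mat_of_cols N (map (fourier_mode N) [0..<N])"

lemma fourier_matrix_carrier [simp]: "fourier_matrix N \<in> carrier_mat N N"
  by (simp add: fourier_matrix_def mat_of_cols_def)

lemma fourier_mode_carrier [simp]: "fourier_mode N k \<in> carrier_vec N"
  by (simp add: fourier_mode_def)

lemma col_fourier_matrix: "k < N \<Longrightarrow> col (fourier_matrix N) k = fourier_mode N k"
  by (simp add: fourier_matrix_def)

lemma index_fourier_matrix:
  "m < N \<Longrightarrow> k < N \<Longrightarrow>
     fourier_matrix N $$ (m, k) = cis (2 * pi * real k * real m / real N)"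
  by (simp add: fourier_matrix_def mat_of_cols_index fourier_mode_def)

text \<open>The second factor is the conjugate transpose divided by \<open>N\<close>, so each entry
  of the product is a normalized character sum. Orthogonality leaves only the diagonal.\<close>

lemma fourier_inversion:
  assumes "N > 0"
  shows "fourier_matrix N *
           mat N N (\<lambda>(k, m). cis (- (2 * pi * real k * real m / real N)) / of_nat N) = 1\<^sub>m N"
    (is "_ * ?G = _")
proof (rule eq_matI)
  fix m m' assume "m < dim_row (1\<^sub>m N :: complex mat)" "m' < dim_col (1\<^sub>m N :: complex mat)"
  then have m: "m < N" "m' < N"
    by auto
  have "(fourier_matrix N * ?G) $$ (m, m') =
      (\<Sum>k<N. cis (2 * pi * real k * real m / real N) *
        (cis (- (2 * pi * real k * real m' / real N)) / of_nat N))"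
    using m carrier_matD[OF fourier_matrix_carrier[of N]]
    by (simp add: scalar_prod_def index_fourier_matrix lessThan_atLeast0)
  \<comment> \<open>The difference is taken in the integers because \<open>m\<close> may be smaller
    than \<open>m'\<close>.\<close>
  also have "\<dots> = (\<Sum>k<N. cis (2 * pi * real k * real_of_int (int m - int m') / real N)) / of_nat N"
    unfolding sum_divide_distrib
    by (intro sum.cong refl)
      (simp add: cis_mult diff_divide_distrib right_diff_distrib)
  also have "\<dots> = (if m = m' then 1 else 0)"
    using sum_cis_character[of N "int m - int m'"] m assms by auto
  finally show "(fourier_matrix N * ?G) $$ (m, m') = 1\<^sub>m N $$ (m, m')"
    using m by simp
qed (use carrier_matD[OF fourier_matrix_carrier[of N]] in auto)

section \<open>Symbol calculus: sums, products and inverses\<close>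

lemma has_fourier_symbol_carrier: "has_fourier_symbol N T s \<Longrightarrow> T \<in> carrier_mat N N"
  by (simp add: has_fourier_symbol_def)

lemma has_fourier_symbol_cong:
  "has_fourier_symbol N T s \<Longrightarrow> (\<And>k. k < N \<Longrightarrow> s k = t k) \<Longrightarrow> has_fourier_symbol N T t"
  by (simp add: has_fourier_symbol_def)

lemma has_fourier_symbol_one: "has_fourier_symbol N (1\<^sub>m N) (\<lambda>k. 1)"
  by (simp add: has_fourier_symbol_def)

lemma has_fourier_symbol_add:
  assumes "has_fourier_symbol N S s" "has_fourier_symbol N T t"
  shows "has_fourier_symbol N (S + T) (\<lambda>k. s k + t k)"
  using assms
  by (auto simp: has_fourier_symbol_def add_mult_distrib_mat_vec[of _ N N] add_smult_distrib_vec)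

lemma has_fourier_symbol_smult:
  assumes "has_fourier_symbol N T t"
  shows "has_fourier_symbol N (c \<cdot>\<^sub>m T) (\<lambda>k. c * t k)"
proof -
  have "(c \<cdot>\<^sub>m T) *\<^sub>v v = c \<cdot>\<^sub>v (T *\<^sub>v v)" if "T \<in> carrier_mat N N" "v \<in> carrier_vec N" for v
    using that by (intro eq_vecI) auto
  then show ?thesis
    using assms by (auto simp: has_fourier_symbol_def smult_smult_assoc)
qed

lemma has_fourier_symbol_diff:
  assumes "has_fourier_symbol N S s" "has_fourier_symbol N T t"
  shows "has_fourier_symbol N (S - T) (\<lambda>k. s k - t k)"
proof -
  have "s k \<cdot>\<^sub>v v - t k \<cdot>\<^sub>v v = (s k - t k) \<cdot>\<^sub>v v" for k and v :: "complex vec"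
    by (intro eq_vecI) (auto simp: left_diff_distrib)
  then show ?thesis
    using assms by (auto simp: has_fourier_symbol_def minus_mult_distrib_mat_vec[of _ N N])
qed

lemma has_fourier_symbol_mult:
  assumes "has_fourier_symbol N S s" "has_fourier_symbol N T t"
  shows "has_fourier_symbol N (S * T) (\<lambda>k. s k * t k)"
  using assms
  by (auto simp: has_fourier_symbol_def assoc_mult_mat_vec[of _ N N _ N] mult_mat_vec[of _ N N]
      smult_smult_assoc mult.commute)

text \<open>Every mode takes the value 1 at grid point 0, so entry 0 recovers the scalar. This
  carries estimates for an explicit symbol over to an arbitrary symbol of the same operator.\<close>

lemma has_fourier_symbol_unique:
  assumes "has_fourier_symbol N T s" "has_fourier_symbol N T t" "k < N"
  shows "s k = t k"
proof -
  have "(s k \<cdot>\<^sub>v fourier_mode N k) $ 0 = (t k \<cdot>\<^sub>v fourier_mode N k) $ 0"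
    using assms by (metis has_fourier_symbol_def)
  then show ?thesis
    using \<open>k < N\<close> by (simp add: fourier_mode_def)
qed

text \<open>Dividing each mode by its symbol gives a preimage of that mode under \<open>T\<close>.
  Collecting these preimages in \<open>F'\<close> yields \<open>T * F' = F\<close>, and the inverse
  transform \<open>G\<close> turns this into the right inverse \<open>F' * G\<close>.\<close>

lemma has_fourier_symbol_right_inverse:
  assumes T: "has_fourier_symbol N T s" and nz: "\<And>k. k < N \<Longrightarrow> s k \<noteq> 0" and "N > 0"
  obtains Q where "Q \<in> carrier_mat N N" "T * Q = 1\<^sub>m N"
proof -
  define F where "F = fourier_matrix N"
  define G where "G = mat N N (\<lambda>(k, m). cis (- (2 * pi * real k * real m / real N)) / complex_of_nat N)"
  define F' where "F' = mat_of_cols N (map (\<lambda>k. inverse (s k) \<cdot>\<^sub>v fourier_mode N k) [0..<N])"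
  have carr: "T \<in> carrier_mat N N" "F \<in> carrier_mat N N" "F' \<in> carrier_mat N N" "G \<in> carrier_mat N N"
    using T by (auto simp: has_fourier_symbol_def F_def G_def F'_def mat_of_cols_def)
  have "T * F' = F"
  proof (rule mat_col_eqI)
    fix k assume "k < dim_col F"
    then have k: "k < N"
      using carr by simp
    have "col (T * F') k = T *\<^sub>v (inverse (s k) \<cdot>\<^sub>v fourier_mode N k)"
      using carr k by (simp add: col_mult2[of _ N N _ N] F'_def)
    also have "\<dots> = fourier_mode N k"
      using T k nz[OF k]
      by (simp add: has_fourier_symbol_def mult_mat_vec[of _ N N] smult_smult_assoc)
    finally show "col (T * F') k = col F k"
      using k by (simp add: F_def col_fourier_matrix)
  qed (use carr in auto)
  then have "T * (F' * G) = 1\<^sub>m N"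
    using assoc_mult_mat[OF carr(1,3,4)] fourier_inversion[OF \<open>N > 0\<close>]
    by (simp only: F_def G_def)
  then show ?thesis
    using that carr by (metis mult_carrier_mat)
qed

text \<open>A right inverse of a square matrix over a field is two-sided. Applying the inverse to
  the eigenvector equation of a mode then shows that its symbol is the reciprocal.\<close>

lemma has_fourier_symbol_inverse:
  assumes T: "has_fourier_symbol N T s" and nz: "\<And>k. k < N \<Longrightarrow> s k \<noteq> 0" and "N > 0"
  shows "invertible_mat T"
    and "has_fourier_symbol N (the (mat_inverse T)) (\<lambda>k. inverse (s k))"
proof -
  have Tc: "T \<in> carrier_mat N N"
    using T by (rule has_fourier_symbol_carrier)
  obtain Q where Q: "Q \<in> carrier_mat N N" "T * Q = 1\<^sub>m N"
    using has_fourier_symbol_right_inverse[OF assms] by blast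
  have QT: "Q * T = 1\<^sub>m N"
    using mat_mult_left_right_inverse[OF Tc Q] .
  then show "invertible_mat T"
    using Tc Q by (auto simp: invertible_mat_def inverts_mat_def)
  \<comment> \<open>The specification of \<open>mat_inverse\<close> rules out \<open>None\<close>
    for units of the matrix ring, so invertibility is recast in that form.\<close>
  have "T \<in> Units (ring_mat TYPE(complex) N x)" for x :: unit
    using Tc Q QT by (auto simp: Units_def ring_mat_def)
  then obtain P where P: "mat_inverse T = Some P"
    using mat_inverse(1)[OF Tc, of "()"] by (cases "mat_inverse T") auto
  have PT: "P * T = 1\<^sub>m N" and Pc: "P \<in> carrier_mat N N"
    using mat_inverse(2)[OF Tc P] by auto
  have "P *\<^sub>v fourier_mode N k = inverse (s k) \<cdot>\<^sub>v fourier_mode N k" if k: "k < N" for k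
  proof -
    have "fourier_mode N k = (P * T) *\<^sub>v fourier_mode N k"
      by (simp add: PT)
    also have "\<dots> = s k \<cdot>\<^sub>v (P *\<^sub>v fourier_mode N k)"
      using T k Tc Pc
      by (simp add: has_fourier_symbol_def assoc_mult_mat_vec[of _ N N _ N] mult_mat_vec[of _ N N])
    finally have "inverse (s k) \<cdot>\<^sub>v fourier_mode N k = inverse (s k) \<cdot>\<^sub>v (s k \<cdot>\<^sub>v (P *\<^sub>v fourier_mode N k))"
      by simp
    then show ?thesis
      using nz[OF k] by (simp add: smult_smult_assoc)
  qed
  then show "has_fourier_symbol N (the (mat_inverse T)) (\<lambda>k. inverse (s k))"
    using P Pc by (simp add: has_fourier_symbol_def)
qed

section \<open>The scalar correction on a single mode\<close>

text \<open>This is the stage symbol minus the preconditioner symbol, divided by the latter. As a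
  scalar function of one mode it can be estimated without matrices.\<close>

definition correction_symbol :: "nat \<Rightarrow> real \<Rightarrow> complex \<Rightarrow> real \<Rightarrow> complex" where
  "correction_symbol j h a b =
     complex_of_real (stage_beta j * h\<^sup>2 * b) * a /
     complex_of_real (1 - stage_alpha j * h * b + stage_beta j * h\<^sup>2 * b\<^sup>2)"

text \<open>The estimates rest on these signs alone, so both stages are treated at once.\<close>

lemma stage_pos [simp]: "stage_alpha j > 0" "stage_beta j > 0"
  by (simp_all add: stage_alpha_def stage_beta_def)

lemma precond_symbol_ge:
  assumes "h > 0" "b \<le> 0"
  shows "1 - stage_alpha j * h * b + stage_beta j * h\<^sup>2 * b\<^sup>2 \<ge> 1 + stage_beta j * h\<^sup>2 * b\<^sup>2"
  using assms stage_pos(1)[of j] by (simp add: mult_nonneg_nonpos mult_nonneg_nonneg less_imp_le)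

lemma precond_symbol_pos:
  assumes "h > 0" "b \<le> 0"
  shows "1 - stage_alpha j * h * b + stage_beta j * h\<^sup>2 * b\<^sup>2 > 0"
proof -
  have "0 \<le> stage_beta j * h\<^sup>2 * b\<^sup>2"
    using stage_pos(2)[of j] by (simp add: less_imp_le)
  with precond_symbol_ge[OF assms, of j] show ?thesis
    by linarith
qed

text \<open>The numerator has modulus \<open>x * \<bar>b\<bar> * cmod a\<close> and the denominator
  is at least \<open>x * b\<^sup>2\<close>. The factor \<open>x\<close> cancels, and with it all
  dependence on \<open>h\<close> and \<open>j\<close>.\<close>

lemma norm_correction_symbol_le:
  assumes "h > 0" "b < 0"
  shows "cmod (correction_symbol j h a b) \<le> cmod a / \<bar>b\<bar>"
proof -
  define x where "x = stage_beta j * h\<^sup>2"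
  define D where "D = 1 - stage_alpha j * h * b + x * b\<^sup>2"
  have x: "x > 0"
    using assms by (simp add: x_def)
  have D: "D \<ge> x * b\<^sup>2" "D > 0"
    using precond_symbol_ge[of h b j] precond_symbol_pos[of h b j] assms by (auto simp: D_def x_def)
  have "cmod (correction_symbol j h a b) = x * \<bar>b\<bar> * cmod a / D"
    unfolding correction_symbol_def x_def[symmetric] D_def[symmetric]
    using D x by (simp add: norm_mult norm_divide)
  also have "\<dots> \<le> x * \<bar>b\<bar> * cmod a / (x * b\<^sup>2)"
    using D x assms by (intro divide_left_mono mult_nonneg_nonneg mult_pos_pos) auto
  also have "\<dots> = cmod a / \<bar>b\<bar>"
    using x assms by (simp add: power2_eq_square field_simps)
  finally show ?thesis .
qed

section \<open>Symbols of the preconditioner, the stage operator and the correction\<close>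

context
  fixes j N :: nat and h :: real and A B :: "complex mat" and a :: "nat \<Rightarrow> complex" and b :: "nat \<Rightarrow> real"
  assumes h: "h > 0" and N: "N > 0" and A: "has_fourier_symbol N A a"
    and B: "has_fourier_symbol N B (\<lambda>k. complex_of_real (b k))" and b: "\<And>k. k < N \<Longrightarrow> b k \<le> 0"
begin

text \<open>The symbol is written as the embedding of one real number so that the real positivity
  result applies to it.\<close>

lemma quad_precond_symbol:
  "has_fourier_symbol N (quad_precond j h B)
     (\<lambda>k. complex_of_real (1 - stage_alpha j * h * b k + stage_beta j * h\<^sup>2 * (b k)\<^sup>2))"
  using has_fourier_symbol_add[OF has_fourier_symbol_diff[OF has_fourier_symbol_one
        has_fourier_symbol_smult[OF B, of "complex_of_real (stage_alpha j * h)"]]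
      has_fourier_symbol_smult[OF has_fourier_symbol_mult[OF B B],
        of "complex_of_real (stage_beta j * h\<^sup>2)"]]
    has_fourier_symbol_carrier[OF B]
  by (simp add: quad_precond_def power2_eq_square mult.assoc)

lemma stage_op_symbol:
  "has_fourier_symbol N (stage_op j h A B)
     (\<lambda>k. 1 - complex_of_real (stage_alpha j * h) * complex_of_real (b k)
        + complex_of_real (stage_beta j * h\<^sup>2) * (complex_of_real (b k) * (a k + complex_of_real (b k))))"
  using has_fourier_symbol_add[OF has_fourier_symbol_diff[OF has_fourier_symbol_one
        has_fourier_symbol_smult[OF B, of "complex_of_real (stage_alpha j * h)"]]
      has_fourier_symbol_smult[OF has_fourier_symbol_mult[OF B has_fourier_symbol_add[OF A B]],
        of "complex_of_real (stage_beta j * h\<^sup>2)"]]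
    has_fourier_symbol_carrier[OF B]
  by (simp add: stage_op_def)

lemma precond_symbol_nonzero:
  assumes "k < N"
  shows "complex_of_real (1 - stage_alpha j * h * b k + stage_beta j * h\<^sup>2 * (b k)\<^sup>2) \<noteq> 0"
  using precond_symbol_pos[OF h b[OF assms], of j] by (metis less_irrefl of_real_eq_0_iff)

lemma invertible_quad_precond: "invertible_mat (quad_precond j h B)"
  using has_fourier_symbol_inverse(1)[OF quad_precond_symbol precond_symbol_nonzero N] .

text \<open>\<open>A\<close> enters the stage operator only through \<open>B * A\<close>, so the
  stage symbol is the preconditioner symbol \<open>D\<close> plus the advective term. Dividing by
  \<open>D\<close> and subtracting 1 leaves that term over \<open>D\<close>.\<close>

lemma precond_correction_symbol:
  "has_fourier_symbol N (precond_correction j h A B) (\<lambda>k. correction_symbol j h (a k) (b k))"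
proof -
  note inv = has_fourier_symbol_inverse(2)[OF quad_precond_symbol precond_symbol_nonzero N]
  note sym = has_fourier_symbol_diff[OF has_fourier_symbol_mult[OF inv stage_op_symbol]
      has_fourier_symbol_one]
  have dim: "dim_row B = N"
    using has_fourier_symbol_carrier[OF B] by simp
  show ?thesis
    unfolding precond_correction_def dim
  proof (rule has_fourier_symbol_cong[OF sym])
    fix k assume k: "k < N"
    define D where "D = complex_of_real (1 - stage_alpha j * h * b k + stage_beta j * h\<^sup>2 * (b k)\<^sup>2)"
    have D0: "D \<noteq> 0"
      using precond_symbol_nonzero[OF k] by (simp only: D_def not_False_eq_True)
    have "1 - complex_of_real (stage_alpha j * h) * complex_of_real (b k)
        + complex_of_real (stage_beta j * h\<^sup>2) * (complex_of_real (b k) * (a k + complex_of_real (b k)))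
      = D + complex_of_real (stage_beta j * h\<^sup>2 * b k) * a k" (is "?M = D + ?n")
      by (simp add: D_def algebra_simps power2_eq_square)
    then have "inverse D * ?M - 1 = ?n / D"
      using D0 by (simp add: field_simps)
    then show "inverse (complex_of_real (1 - stage_alpha j * h * b k + stage_beta j * h\<^sup>2 * (b k)\<^sup>2)) * ?M - 1
        = correction_symbol j h (a k) (b k)"
      by (simp only: correction_symbol_def D_def)
  qed
qed

end

section \<open>Advection-diffusion and clustering at high frequency\<close>

text \<open>The general bound applies with \<open>cmod (a k)\<close> linear and
  \<open>\<bar>b k\<bar>\<close> quadratic in the wave number, so one factor
  \<open>\<bar>\<xi> k\<bar>\<close> survives in the denominator.\<close>

lemma advection_diffusion_correction_le:
  assumes "\<nu> > 0" "h > 0" "N > 0" and AD: "advection_diffusion N c \<nu> \<xi> A B"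
    and E: "has_fourier_symbol N (precond_correction j h A B) E" and k: "k < N" "\<xi> k \<noteq> 0"
  shows "cmod (E k) \<le> \<bar>c\<bar> / (\<nu> * \<bar>\<xi> k\<bar>)"
proof -
  define a where "a k = \<i> * complex_of_real (c * \<xi> k)" for k
  define b where "b k = - \<nu> * (\<xi> k)\<^sup>2" for k
  have "has_fourier_symbol N A a" "has_fourier_symbol N B (\<lambda>k. complex_of_real (b k))"
    using AD unfolding advection_diffusion_def a_def b_def by blast+
  moreover have "b k \<le> 0" for k
    using \<open>\<nu> > 0\<close> by (simp add: b_def)
  ultimately have "has_fourier_symbol N (precond_correction j h A B)
      (\<lambda>k. correction_symbol j h (a k) (b k))"
    using precond_correction_symbol assms(2,3) by blast
  then have "E k = correction_symbol j h (a k) (b k)"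
    using has_fourier_symbol_unique[OF E _ k(1)] by blast
  moreover have "b k < 0"
    using assms by (simp add: b_def)
  ultimately have "cmod (E k) \<le> cmod (a k) / \<bar>b k\<bar>"
    using norm_correction_symbol_le \<open>h > 0\<close> by metis
  also have "\<dots> = \<bar>c\<bar> * \<bar>\<xi> k\<bar> / (\<nu> * (\<bar>\<xi> k\<bar> * \<bar>\<xi> k\<bar>))"
    using \<open>\<nu> > 0\<close> by (simp add: a_def b_def norm_mult abs_mult power2_eq_square)
  also have "\<dots> = \<bar>c\<bar> / (\<nu> * \<bar>\<xi> k\<bar>)"
    using k \<open>\<nu> > 0\<close> by (simp del: abs_mult_self_eq)
  finally show ?thesis .
qed

text \<open>Uniformity lies in the order of quantifiers: \<open>R\<close> is fixed before the step
  size, the grid and the operators, hence before \<open>h\<close> times the diffusion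
  symbol.\<close>

lemma advection_diffusion_clustering:
  fixes c \<nu> :: real
  assumes "\<nu> > 0" "\<epsilon> > 0"
  shows "\<exists>R>0. \<forall>h N \<xi> A B E. h > 0 \<and> N > 0 \<and> advection_diffusion N c \<nu> \<xi> A B \<and>
           has_fourier_symbol N (precond_correction j h A B) E \<longrightarrow>
             (\<forall>k<N. \<bar>\<xi> k\<bar> \<ge> R \<longrightarrow> cmod (E k) < \<epsilon>)"
\<comment> \<open>The threshold comes from solving the bound for the wave number. The added 1 makes
  the final inequality strict and keeps \<open>R\<close> positive even when
  \<open>c = 0\<close>.\<close>
proof (intro exI[of _ "(\<bar>c\<bar> + 1) / (\<nu> * \<epsilon>)"] conjI allI impI; (elim conjE)?)
  show R: "(\<bar>c\<bar> + 1) / (\<nu> * \<epsilon>) > 0"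
    using assms by (simp add: add_nonneg_pos)
  fix h N \<xi> A B E k
  assume *: "h > 0" "N > 0" "advection_diffusion N c \<nu> \<xi> A B"
    "has_fourier_symbol N (precond_correction j h A B) E" "k < N"
    and large: "(\<bar>c\<bar> + 1) / (\<nu> * \<epsilon>) \<le> \<bar>\<xi> k\<bar>"
  have \<xi>: "\<bar>\<xi> k\<bar> > 0"
    using R large by linarith
  then have "cmod (E k) \<le> \<bar>c\<bar> / (\<nu> * \<bar>\<xi> k\<bar>)"
    using advection_diffusion_correction_le[OF \<open>\<nu> > 0\<close> *] by simp
  also have "\<bar>c\<bar> + 1 \<le> \<epsilon> * (\<nu> * \<bar>\<xi> k\<bar>)"
    using large assms by (simp add: field_simps)
  then have "\<bar>c\<bar> / (\<nu> * \<bar>\<xi> k\<bar>) < \<epsilon>"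
    using assms \<xi> by (simp add: pos_divide_less_eq)
  finally show "cmod (E k) < \<epsilon>" .
qed

theorem proposition7p2:
  fixes j :: nat
  assumes "j \<in> {1, 2}"
  shows
    "(\<forall>(h::real) (N::nat) (A::complex mat) (B::complex mat) (a::nat \<Rightarrow> complex) (b::nat \<Rightarrow> real).
        h > 0 \<and> N > 0 \<and>
        has_fourier_symbol N A a \<and>
        has_fourier_symbol N B (\<lambda>k. complex_of_real (b k)) \<and> (\<forall>k<N. b k \<le> 0) \<longrightarrow>
          invertible_mat (quad_precond j h B) \<and>
          (\<exists>E. has_fourier_symbol N (precond_correction j h A B) E \<and>
             (\<forall>k<N. E k = complex_of_real (stage_beta j * h\<^sup>2 * b k) * a k /
                         complex_of_real (1 - stage_alpha j * h * b k + stage_beta j * h\<^sup>2 * (b k)\<^sup>2)) \<and>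
             (\<forall>k<N. b k \<noteq> 0 \<longrightarrow> cmod (E k) \<le> cmod (a k) / \<bar>b k\<bar>)))
     \<and>
     (\<forall>(c::real) (\<nu>::real). \<nu> > 0 \<longrightarrow>
        (\<forall>(h::real) (N::nat) (\<xi>::nat \<Rightarrow> real) (A::complex mat) (B::complex mat) (E::nat \<Rightarrow> complex).
           h > 0 \<and> N > 0 \<and> advection_diffusion N c \<nu> \<xi> A B \<and>
           has_fourier_symbol N (precond_correction j h A B) E \<longrightarrow>
             (\<forall>k<N. \<xi> k \<noteq> 0 \<longrightarrow> cmod (E k) \<le> \<bar>c\<bar> / (\<nu> * \<bar>\<xi> k\<bar>)))
        \<and>
        (\<forall>\<epsilon>>0. \<exists>R>0. 
           \<forall>(h::real) (N::nat) (\<xi>::nat \<Rightarrow> real) (A::complex mat) (B::complex mat) (E::nat \<Rightarrow> complex).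
             h > 0 \<and> N > 0 \<and> advection_diffusion N c \<nu> \<xi> A B \<and>
             has_fourier_symbol N (precond_correction j h A B) E \<longrightarrow>
               (\<forall>k<N. \<bar>\<xi> k\<bar> \<ge> R \<longrightarrow> cmod (E k) < \<epsilon>)))"
proof (intro conjI allI impI; (elim conjE)?)
  fix h :: real and N :: nat and A B :: "complex mat" and a :: "nat \<Rightarrow> complex" and b :: "nat \<Rightarrow> real"
  assume *: "h > 0" "N > 0" "has_fourier_symbol N A a"
    "has_fourier_symbol N B (\<lambda>k. complex_of_real (b k))" and b: "\<forall>k<N. b k \<le> 0"
  show "invertible_mat (quad_precond j h B)"
    using invertible_quad_precond[OF *] b by blast
  \<comment> \<open>Together with \<open>b k \<le> 0\<close>, a nonzero \<open>b k\<close> is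
    negative, as the scalar bound requires.\<close>
  have le: "cmod (correction_symbol j h (a k) (b k)) \<le> cmod (a k) / \<bar>b k\<bar>" if "k < N" "b k \<noteq> 0" for k
    using norm_correction_symbol_le[OF \<open>h > 0\<close>, of "b k" j "a k"] b that by force
  have sym: "has_fourier_symbol N (precond_correction j h A B) (\<lambda>k. correction_symbol j h (a k) (b k))"
    using precond_correction_symbol[OF *] b by blast
  show "\<exists>E. has_fourier_symbol N (precond_correction j h A B) E \<and>
      (\<forall>k<N. E k = complex_of_real (stage_beta j * h\<^sup>2 * b k) * a k /
        complex_of_real (1 - stage_alpha j * h * b k + stage_beta j * h\<^sup>2 * (b k)\<^sup>2)) \<and>
      (\<forall>k<N. b k \<noteq> 0 \<longrightarrow> cmod (E k) \<le> cmod (a k) / \<bar>b k\<bar>)"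
    using sym le by (intro exI[of _ "\<lambda>k. correction_symbol j h (a k) (b k)"] conjI allI impI)
      (simp_all only: correction_symbol_def)
\<comment> \<open>What remains is the pointwise advection-diffusion bound and its uniform limit
  form.\<close>
qed (use advection_diffusion_correction_le advection_diffusion_clustering in blast)+

end
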